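(* Let $\mathbf p=(p_1,\dots,p_r)$ and $\mathbf q=(q_1,\dots,q_r)$ be probability distributions on $\mathcal X=\{c_1,\dots,c_r\}$ with $p_j>0$ and $q_j>0$ for all $j\in D$, and let $\phi:[0,1]^2\to\mathbb R$ be a measurable function having continuous second order partial derivatives. Let $\widehat{\mathbf p}_n$ and $\widehat{\mathbf q}_m$ be the empirical distributions of i.i.d. samples $X_1,\dots,X_n$ from $\mathbf p$ and $Y_1,\dots,Y_m$ from $\mathbf q$. Then: (a) (One sample) $$\limsup_{n\to+\infty}\frac{|J^{(s)}(\widehat{\mathbf p}_n,\mathbf q)-J^{(s)}(\mathbf p,\mathbf q)|}{a_n}\le\tfrac12\,(A_{1,p}+A_{4,p})\quad\text{a.s.},$$ $$\limsup_{m\to+\infty}\frac{|J^{(s)}(\mathbf p,\widehat{\mathbf q}_m)-J^{(s)}(\mathbf p,\mathbf q)|}{b_m}\le\tfrac12\,(A_{2,q}+A_{3,q})\quad\text{a.s.}$$ (b) (Two samples) $$\limsup_{(n,m)\to(+\infty,+\infty)}\frac{|J^{(s)}(\widehat{\mathbf p}_n,\widehat{\mathbf q}_m)-J^{(s)}(\mathbf p,\mathbf q)|}{c_{n,m}}\le\tfrac12\,(A_{1,p}+A_{2,q}+A_{3,q}+A_{4,p})\quad\text{a.s.}$$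
   Context: $\mathcal X=\{c_1,\dots,c_r\}$ with $r\ge 2$ is a finite set of distinct points and $D=\{1,\dots,r\}$. A probability distribution $\mathbf p$ on $\mathcal X$ is identified with the vector $(p_1,\dots,p_r)$, $p_j$ being the mass of $c_j$. $X_1,X_2,\dots$ are i.i.d. with $\mathbb P(X_i=c_j)=p_j$, and $Y_1,Y_2,\dots$ are i.i.d. with $\mathbb P(Y_i=c_j)=q_j$; the two sequences are independent of each other. Empirical probabilities: $\widehat p_n^{c_j}=\frac1n\sum_{i=1}^n 1_{\{X_i=c_j\}}$, $\widehat q_m^{c_j}=\frac1m\sum_{i=1}^m 1_{\{Y_i=c_j\}}$, $\widehat{\mathbf p}_n=(\widehat p_n^{c_j})_{j\in D}$, $\widehat{\mathbf q}_m=(\widehat q_m^{c_j})_{j\in D}$. $a_n=\sup_{j\in D}|\widehat p_n^{c_j}-p_j|$, $b_m=\sup_{j\in D}|\widehat q_m^{c_j}-q_j|$, $c_{n,m}=\max(a_n,b_m)$. The $\phi$-divergence is $J(\mathbf p,\mathbf q)=\sum_{j\in D}\phi(p_j,q_j)$ and its symmetrized form is $J^{(s)}(\mathbf p,\mathbf q)=\frac12\bigl(J(\mathbf p,\mathbf q)+J(\mathbf q,\mathbf p)\bigr)$, for any probability distributions $\mathbf p,\mathbf q$ on $\mathcal X$. Write $\phi_1^{(1)}(s,t)=\frac{\partial\phi}{\partial s}(s,t)$, $\phi_2^{(1)}(s,t)=\frac{\partial\phi}{\partial t}(s,t)$, and $A_{1,p}=\sum_{j\in D}|\phi_1^{(1)}(p_j,q_j)|$,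 $A_{2,q}=\sum_{j\in D}|\phi_2^{(1)}(p_j,q_j)|$, $A_{3,q}=\sum_{j\in D}|\phi_1^{(1)}(q_j,p_j)|$, $A_{4,p}=\sum_{j\in D}|\phi_2^{(1)}(q_j,p_j)|$. Conventions: a ratio $0/0$ is read as $0$; $\limsup_{(n,m)\to(+\infty,+\infty)}x_{n,m}=\lim_{N\to\infty}\sup_{n,m\ge N}x_{n,m}$. *)

theory Defs
  imports "HOL-Probability.Probability"
begin

text \<open>
  A distribution on the points \<open>c 1, \<dots>, c r\<close> is given by its masses \<open>p 1, \<dots>, p r\<close>;
  values of \<open>p\<close> outside \<open>{1..r}\<close> are irrelevant.
\<close>

definition prob_vector :: "nat \<Rightarrow> (nat \<Rightarrow> real) \<Rightarrow> bool" where
  "prob_vector r p \<longleftrightarrow> (\<forall>j\<in>{1..r}. 0 \<le> p j) \<and> (\<Sum>j\<in>{1..r}. p j) = 1"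

definition empirical :: "(nat \<Rightarrow> 'b) \<Rightarrow> (nat \<Rightarrow> 'a \<Rightarrow> 'b) \<Rightarrow> nat \<Rightarrow> 'a \<Rightarrow> nat \<Rightarrow> real" where
  "empirical c X n \<omega> j = (1 / real n) * (\<Sum>i=1..n. indicator {c j} (X i \<omega>))"

definition sup_dev :: "nat \<Rightarrow> (nat \<Rightarrow> real) \<Rightarrow> (nat \<Rightarrow> real) \<Rightarrow> real" where
  "sup_dev r u v = (SUP j\<in>{1..r}. \<bar>u j - v j\<bar>)"

definition phi_div :: "nat \<Rightarrow> (real \<times> real \<Rightarrow> real) \<Rightarrow> (nat \<Rightarrow> real) \<Rightarrow> (nat \<Rightarrow> real) \<Rightarrow> real" where
  "phi_div r \<phi> p q = (\<Sum>j\<in>{1..r}. \<phi> (p j, q j))"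

definition sym_phi_div :: "nat \<Rightarrow> (real \<times> real \<Rightarrow> real) \<Rightarrow> (nat \<Rightarrow> real) \<Rightarrow> (nat \<Rightarrow> real) \<Rightarrow> real" where
  "sym_phi_div r \<phi> p q = (1/2) * (phi_div r \<phi> p q + phi_div r \<phi> q p)"

abbreviation unit_square :: "(real \<times> real) set" where
  "unit_square \<equiv> {0..1} \<times> {0..1}"

text \<open>
  Functions on the closed unit square are represented by total functions whose values outside
  the square play no role. Hence derivatives are taken within \<open>{0..1}\<close>: they are the usual
  two-sided ones in the interior and one-sided at the end points.
\<close>

definition partial1 :: "(real \<times> real \<Rightarrow> real) \<Rightarrow> real \<times> real \<Rightarrow> real" where
  "partial1 f z = vector_derivative (\<lambda>s. f (s, snd z)) (at (fst z) within {0..1})"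

definition partial2 :: "(real \<times> real \<Rightarrow> real) \<Rightarrow> real \<times> real \<Rightarrow> real" where
  "partial2 f z = vector_derivative (\<lambda>t. f (fst z, t)) (at (snd z) within {0..1})"

definition has_partials :: "(real \<times> real \<Rightarrow> real) \<Rightarrow> bool" where
  "has_partials f \<longleftrightarrow> (\<forall>s\<in>{0..1}. \<forall>t\<in>{0..1}.
     (\<lambda>u. f (u, t)) differentiable (at s within {0..1}) \<and>
     (\<lambda>u. f (s, u)) differentiable (at t within {0..1}))"

definition cont_second_partials :: "(real \<times> real \<Rightarrow> real) \<Rightarrow> bool" where
  "cont_second_partials f \<longleftrightarrow>
     has_partials f \<and> has_partials (partial1 f) \<and> has_partials (partial2 f) \<and>
     continuous_on unit_square (partial1 (partial1 f)) \<and>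
     continuous_on unit_square (partial2 (partial1 f)) \<and>
     continuous_on unit_square (partial1 (partial2 f)) \<and>
     continuous_on unit_square (partial2 (partial2 f))"

definition A1 :: "nat \<Rightarrow> (real \<times> real \<Rightarrow> real) \<Rightarrow> (nat \<Rightarrow> real) \<Rightarrow> (nat \<Rightarrow> real) \<Rightarrow> real" where
  "A1 r \<phi> p q = (\<Sum>j\<in>{1..r}. \<bar>partial1 \<phi> (p j, q j)\<bar>)"

definition A2 :: "nat \<Rightarrow> (real \<times> real \<Rightarrow> real) \<Rightarrow> (nat \<Rightarrow> real) \<Rightarrow> (nat \<Rightarrow> real) \<Rightarrow> real" where
  "A2 r \<phi> p q = (\<Sum>j\<in>{1..r}. \<bar>partial2 \<phi> (p j, q j)\<bar>)"

definition A3 :: "nat \<Rightarrow> (real \<times> real \<Rightarrow> real) \<Rightarrow> (nat \<Rightarrow> real) \<Rightarrow> (nat \<Rightarrow> real) \<Rightarrow> real" where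
  "A3 r \<phi> p q = (\<Sum>j\<in>{1..r}. \<bar>partial1 \<phi> (q j, p j)\<bar>)"

definition A4 :: "nat \<Rightarrow> (real \<times> real \<Rightarrow> real) \<Rightarrow> (nat \<Rightarrow> real) \<Rightarrow> (nat \<Rightarrow> real) \<Rightarrow> real" where
  "A4 r \<phi> p q = (\<Sum>j\<in>{1..r}. \<bar>partial2 \<phi> (q j, p j)\<bar>)"

text \<open>The suprema decrease in \<open>N\<close>, so the limit below always exists in \<^typ>\<open>ereal\<close>.\<close>

definition double_limsup :: "(nat \<Rightarrow> nat \<Rightarrow> ereal) \<Rightarrow> ereal" where
  "double_limsup x = lim (\<lambda>N. SUP (n, m)\<in>{N..} \<times> {N..}. x n m)"

lemma double_limsup_eq_INF:
  "double_limsup x = (INF N. SUP (n, m)\<in>{N..} \<times> {N..}. x n m)"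
proof -
  have "decseq (\<lambda>N. SUP (n, m)\<in>{N..} \<times> {N..}. x n m)"
    by (intro decseq_SucI SUP_subset_mono) auto
  from LIMSEQ_INF[OF this] show ?thesis
    unfolding double_limsup_def by (rule limI)
qed

end

theory Submission
  imports Defs
begin

text \<open>
  On the square the first partial derivatives of \<open>\<phi>\<close> are Lipschitz, because the second ones are
  bounded. Two applications of the mean value theorem then expand \<open>\<phi>\<close> to first order with a
  quadratic remainder, uniformly on the square, so each ratio is at most its claimed bound plus a
  constant times the deviation in the denominator. These deviations tend to \<open>0\<close> almost surely by
  the strong law, which for bounded variables follows from Hoeffding's inequality and the
  Borel--Cantelli lemma.
\<close>

section \<open>First order expansion on the unit square\<close>

text \<open>Derivatives within \<open>{0..1}\<close> restrict to the segment between
  \<open>s\<close> and \<open>s'\<close>, so the usual mean value theorem applies even if the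
  segment touches an end point. The bound on \<open>\<bar>\<xi> - s\<bar>\<close> says that
  \<open>\<xi>\<close> is no farther from \<open>s\<close> than \<open>s'\<close> is, whichever of
  the two is larger.\<close>

lemma mvt_unit_interval:
  fixes g :: "real \<Rightarrow> real"
  assumes g: "\<And>u. u \<in> {0..1} \<Longrightarrow> g differentiable (at u within {0..1})"
    and s: "s \<in> {0..1}" and s': "s' \<in> {0..1}"
  obtains \<xi> where "\<xi> \<in> {0..1}" "\<bar>\<xi> - s\<bar> \<le> \<bar>s' - s\<bar>"
    "g s' - g s = vector_derivative g (at \<xi> within {0..1}) * (s' - s)"
proof -
  let ?D = "\<lambda>x. vector_derivative g (at x within {0..1})"
  \<comment> \<open>The ordered case, stated for arbitrary \<open>x\<close> and \<open>y\<close> so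
    that it covers both orders of \<open>s\<close> and \<open>s'\<close>.\<close>
  have *: "\<exists>\<xi>\<in>{x..y}. g y - g x = (y - x) * ?D \<xi>" if "x \<le> y" "x \<in> {0..1}" "y \<in> {0..1}" for x y
  proof (rule mvt_very_simple[OF \<open>x \<le> y\<close>])
    fix z assume z: "x \<le> z" "z \<le> y"
    then have "(g has_vector_derivative ?D z) (at z within {0..1})"
      using g that by (auto simp: vector_derivative_works)
    then have "(g has_vector_derivative ?D z) (at z within {x..y})"
      by (rule has_vector_derivative_within_subset) (use that in auto)
    then show "(g has_derivative (\<lambda>h. h * ?D z)) (at z within {x..y})"
      by (simp add: has_vector_derivative_def)
  qed
  show thesis
  proof (cases "s \<le> s'")
    case True
    with * s s' obtain \<xi> where "\<xi> \<in> {s..s'}" "g s' - g s = (s' - s) * ?D \<xi>" by blast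
    with s s' show thesis by (intro that[of \<xi>]) auto
  next
    case False
    then have "s' \<le> s" by simp
    with * s s' obtain \<xi> where "\<xi> \<in> {s'..s}" "g s - g s' = (s - s') * ?D \<xi>" by blast
    with s s' show thesis by (intro that[of \<xi>]) (auto simp: algebra_simps)
  qed
qed

text \<open>Go from \<open>(s, t)\<close> to \<open>(s', t')\<close> through the corner
  \<open>(s, t')\<close>, changing one coordinate at a time; each leg is a one-variable mean value
  theorem.\<close>

lemma has_partials_mvt:
  assumes f: "has_partials f"
    and s: "s \<in> {0..1}" and t: "t \<in> {0..1}" and s': "s' \<in> {0..1}" and t': "t' \<in> {0..1}"
  obtains \<xi> \<eta> where "\<xi> \<in> {0..1}" "\<eta> \<in> {0..1}"
    "\<bar>\<xi> - s\<bar> \<le> \<bar>s' - s\<bar>" "\<bar>\<eta> - t\<bar> \<le> \<bar>t' - t\<bar>"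
    "f (s', t') - f (s, t) = partial1 f (\<xi>, t') * (s' - s) + partial2 f (s, \<eta>) * (t' - t)"
proof -
  obtain \<xi> where \<xi>: "\<xi> \<in> {0..1}" "\<bar>\<xi> - s\<bar> \<le> \<bar>s' - s\<bar>"
      "f (s', t') - f (s, t') = partial1 f (\<xi>, t') * (s' - s)"
    using mvt_unit_interval[of "\<lambda>u. f (u, t')" s s'] f s s' t'
    unfolding has_partials_def partial1_def by auto
  obtain \<eta> where \<eta>: "\<eta> \<in> {0..1}" "\<bar>\<eta> - t\<bar> \<le> \<bar>t' - t\<bar>"
      "f (s, t') - f (s, t) = partial2 f (s, \<eta>) * (t' - t)"
    using mvt_unit_interval[of "\<lambda>u. f (s, u)" t t'] f s t t'
    unfolding has_partials_def partial2_def by auto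
  show thesis
    using \<xi> \<eta> by (intro that[of \<xi> \<eta>]) auto
qed

text \<open>On the compact square the continuous partials share a bound \<open>B\<close>, which
  controls both slopes in the mean value formula. The lemma is meant for an \<open>f\<close> that is
  itself a first partial derivative.\<close>

lemma has_partials_lipschitz:
  assumes f: "has_partials f"
    and c1: "continuous_on unit_square (partial1 f)"
    and c2: "continuous_on unit_square (partial2 f)"
  obtains B where "B \<ge> 0"
    "\<And>s t s' t'. \<lbrakk>s \<in> {0..1}; t \<in> {0..1}; s' \<in> {0..1}; t' \<in> {0..1}\<rbrakk>
       \<Longrightarrow> \<bar>f (s', t') - f (s, t)\<bar> \<le> B * (\<bar>s' - s\<bar> + \<bar>t' - t\<bar>)"
proof -
  have cpt: "compact unit_square"
    by (intro compact_Times) auto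
  have "bounded (partial1 f ` unit_square \<union> partial2 f ` unit_square)"
    using c1 c2 cpt by (auto intro: compact_imp_bounded compact_continuous_image)
  then obtain B where "B > 0"
    and B: "\<And>x. x \<in> partial1 f ` unit_square \<union> partial2 f ` unit_square \<Longrightarrow> norm x \<le> B"
    unfolding bounded_pos by blast
  show thesis
  proof (rule that[of B])
    fix s t s' t' :: real
    assume st: "s \<in> {0..1}" "t \<in> {0..1}" "s' \<in> {0..1}" "t' \<in> {0..1}"
    obtain \<xi> \<eta> where m: "\<xi> \<in> {0..1}" "\<eta> \<in> {0..1}"
      "f (s', t') - f (s, t) = partial1 f (\<xi>, t') * (s' - s) + partial2 f (s, \<eta>) * (t' - t)"
      using has_partials_mvt[OF f st] by blast
    have "\<bar>partial1 f (\<xi>, t')\<bar> \<le> B" "\<bar>partial2 f (s, \<eta>)\<bar> \<le> B"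
      using m st by (auto intro!: B[unfolded real_norm_def])
    then have "\<bar>partial1 f (\<xi>, t') * (s' - s)\<bar> \<le> B * \<bar>s' - s\<bar>"
      "\<bar>partial2 f (s, \<eta>) * (t' - t)\<bar> \<le> B * \<bar>t' - t\<bar>"
      by (auto simp: abs_mult intro: mult_right_mono)
    then show "\<bar>f (s', t') - f (s, t)\<bar> \<le> B * (\<bar>s' - s\<bar> + \<bar>t' - t\<bar>)"
      unfolding m(3) by (simp add: distrib_left)
  qed (use \<open>B > 0\<close> in simp)
qed

text \<open>The mean value formula evaluates the partials at intermediate points. Since they are
  Lipschitz, moving them to the base point \<open>(s, t)\<close> changes each slope by an amount
  linear in the displacement, hence the value by a quadratic amount. \<open>B\<close> does not
  depend on the base point.\<close>

lemma cont_second_partials_expansion: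
  assumes f: "cont_second_partials f"
  obtains B where "B \<ge> 0"
    "\<And>s t s' t'. \<lbrakk>s \<in> {0..1}; t \<in> {0..1}; s' \<in> {0..1}; t' \<in> {0..1}\<rbrakk>
       \<Longrightarrow> \<bar>f (s', t') - f (s, t)\<bar> \<le> \<bar>partial1 f (s, t)\<bar> * \<bar>s' - s\<bar> + \<bar>partial2 f (s, t)\<bar> * \<bar>t' - t\<bar>
             + B * (\<bar>s' - s\<bar> + \<bar>t' - t\<bar>)\<^sup>2"
proof -
  from f have f1: "has_partials f" by (simp add: cont_second_partials_def)
  obtain B1 where B1: "B1 \<ge> 0" "\<And>s t s' t'. \<lbrakk>s \<in> {0..1}; t \<in> {0..1}; s' \<in> {0..1}; t' \<in> {0..1}\<rbrakk>
       \<Longrightarrow> \<bar>partial1 f (s', t') - partial1 f (s, t)\<bar> \<le> B1 * (\<bar>s' - s\<bar> + \<bar>t' - t\<bar>)"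
    using has_partials_lipschitz[of "partial1 f"] f unfolding cont_second_partials_def by blast
  obtain B2 where B2: "B2 \<ge> 0" "\<And>s t s' t'. \<lbrakk>s \<in> {0..1}; t \<in> {0..1}; s' \<in> {0..1}; t' \<in> {0..1}\<rbrakk>
       \<Longrightarrow> \<bar>partial2 f (s', t') - partial2 f (s, t)\<bar> \<le> B2 * (\<bar>s' - s\<bar> + \<bar>t' - t\<bar>)"
    using has_partials_lipschitz[of "partial2 f"] f unfolding cont_second_partials_def by blast
  show thesis
  proof (rule that[of "B1 + B2"])
    fix s t s' t' :: real
    assume st: "s \<in> {0..1}" "t \<in> {0..1}" "s' \<in> {0..1}" "t' \<in> {0..1}"
    \<comment> \<open>Both intermediate points, \<open>(\<xi>, t')\<close> and
      \<open>(s, \<eta>)\<close>, lie within l1 distance \<open>h\<close> of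
      \<open>(s, t)\<close>.\<close>
    define h where "h = \<bar>s' - s\<bar> + \<bar>t' - t\<bar>"
    obtain \<xi> \<eta> where m: "\<xi> \<in> {0..1}" "\<eta> \<in> {0..1}"
      "\<bar>\<xi> - s\<bar> \<le> \<bar>s' - s\<bar>" "\<bar>\<eta> - t\<bar> \<le> \<bar>t' - t\<bar>"
      "f (s', t') - f (s, t) = partial1 f (\<xi>, t') * (s' - s) + partial2 f (s, \<eta>) * (t' - t)"
      using has_partials_mvt[OF f1 st] by blast
    have "\<bar>partial1 f (\<xi>, t') - partial1 f (s, t)\<bar> \<le> B1 * (\<bar>\<xi> - s\<bar> + \<bar>t' - t\<bar>)"
      using st m by (intro B1)
    also have "\<dots> \<le> B1 * h"
      using m B1 by (intro mult_left_mono) (auto simp: h_def)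
    finally have 1: "\<bar>partial1 f (\<xi>, t')\<bar> \<le> \<bar>partial1 f (s, t)\<bar> + B1 * h" by linarith
    have "\<bar>partial2 f (s, \<eta>) - partial2 f (s, t)\<bar> \<le> B2 * (\<bar>s - s\<bar> + \<bar>\<eta> - t\<bar>)"
      using st m by (intro B2)
    also have "\<dots> \<le> B2 * h"
      using m B2 by (intro mult_left_mono) (auto simp: h_def)
    finally have 2: "\<bar>partial2 f (s, \<eta>)\<bar> \<le> \<bar>partial2 f (s, t)\<bar> + B2 * h" by linarith
    have "\<bar>f (s', t') - f (s, t)\<bar>
        \<le> \<bar>partial1 f (\<xi>, t')\<bar> * \<bar>s' - s\<bar> + \<bar>partial2 f (s, \<eta>)\<bar> * \<bar>t' - t\<bar>"
      unfolding m(5) abs_mult[symmetric] by (rule abs_triangle_ineq)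
    also have "\<dots> \<le> (\<bar>partial1 f (s, t)\<bar> + B1 * h) * \<bar>s' - s\<bar> + (\<bar>partial2 f (s, t)\<bar> + B2 * h) * \<bar>t' - t\<bar>"
      using 1 2 by (intro add_mono mult_right_mono) auto
    also have "\<dots> = \<bar>partial1 f (s, t)\<bar> * \<bar>s' - s\<bar> + \<bar>partial2 f (s, t)\<bar> * \<bar>t' - t\<bar>
        + (B1 * h * \<bar>s' - s\<bar> + B2 * h * \<bar>t' - t\<bar>)"
      by (simp add: algebra_simps)
    \<comment> \<open>Each single increment is at most \<open>h\<close>, so both corrections become
      multiples of the square of \<open>h\<close>.\<close>
    also have "B1 * h * \<bar>s' - s\<bar> + B2 * h * \<bar>t' - t\<bar> \<le> B1 * h * h + B2 * h * h"
      using B1 B2 by (intro add_mono mult_left_mono) (auto simp: h_def)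
    also have "\<dots> = (B1 + B2) * (\<bar>s' - s\<bar> + \<bar>t' - t\<bar>)\<^sup>2"
      by (simp add: h_def power2_eq_square algebra_simps)
    finally show "\<bar>f (s', t') - f (s, t)\<bar>
        \<le> \<bar>partial1 f (s, t)\<bar> * \<bar>s' - s\<bar> + \<bar>partial2 f (s, t)\<bar> * \<bar>t' - t\<bar>
             + (B1 + B2) * (\<bar>s' - s\<bar> + \<bar>t' - t\<bar>)\<^sup>2"
      by simp
  qed (use B1 B2 in simp)
qed

section \<open>Supremum deviations and the expansion of the divergences\<close>

lemma abs_diff_le_sup_dev:
  assumes "j \<in> {1..r}"
  shows "\<bar>u j - v j\<bar> \<le> sup_dev r u v"
  unfolding sup_dev_def using assms by (intro cSUP_upper) auto

text \<open>\<open>r \<ge> 1\<close> supplies the index 1, whose deviation lies below the supremum;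
  over an empty index set the real supremum has no determined value.\<close>

lemma sup_dev_nonneg: "r \<ge> 1 \<Longrightarrow> 0 \<le> sup_dev r u v"
  using abs_diff_le_sup_dev[of 1 r u v] by force

lemma sup_dev_self: "r \<ge> 1 \<Longrightarrow> sup_dev r u u = 0"
  by (simp add: sup_dev_def)

text \<open>Reduces convergence of the supremum to convergence in each of finitely many
  coordinates.\<close>

lemma sup_dev_le_sum: "r \<ge> 1 \<Longrightarrow> sup_dev r u v \<le> (\<Sum>j\<in>{1..r}. \<bar>u j - v j\<bar>)"
  unfolding sup_dev_def by (intro cSUP_least) (auto intro!: member_le_sum)

lemma sum_weighted_deviation_le:
  fixes g :: "nat \<Rightarrow> real"
  assumes "\<And>j. j \<in> {1..r} \<Longrightarrow> 0 \<le> g j"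
  shows "(\<Sum>j\<in>{1..r}. g j * \<bar>u j - v j\<bar>) \<le> (\<Sum>j\<in>{1..r}. g j) * sup_dev r u v"
  unfolding sum_distrib_right
  using assms by (intro sum_mono mult_left_mono abs_diff_le_sup_dev)

text \<open>The pointwise expansion enters as a premise so that one \<open>B\<close> serves for both
  orders of the arguments. Bounding every deviation by its supremum leaves \<open>r\<close> equal
  remainders, whence the factor \<open>real r\<close>.\<close>

lemma phi_div_expansion:
  assumes B: "B \<ge> 0"
    "\<And>s t s' t'. \<lbrakk>s \<in> {0..1}; t \<in> {0..1}; s' \<in> {0..1}; t' \<in> {0..1}\<rbrakk>
       \<Longrightarrow> \<bar>\<phi> (s', t') - \<phi> (s, t)\<bar> \<le> \<bar>partial1 \<phi> (s, t)\<bar> * \<bar>s' - s\<bar> + \<bar>partial2 \<phi> (s, t)\<bar> * \<bar>t' - t\<bar>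
             + B * (\<bar>s' - s\<bar> + \<bar>t' - t\<bar>)\<^sup>2"
    and "\<And>j. j \<in> {1..r} \<Longrightarrow> p j \<in> {0..1}" "\<And>j. j \<in> {1..r} \<Longrightarrow> q j \<in> {0..1}"
    and "\<And>j. j \<in> {1..r} \<Longrightarrow> p' j \<in> {0..1}" "\<And>j. j \<in> {1..r} \<Longrightarrow> q' j \<in> {0..1}"
  shows "\<bar>phi_div r \<phi> p' q' - phi_div r \<phi> p q\<bar>
    \<le> (\<Sum>j\<in>{1..r}. \<bar>partial1 \<phi> (p j, q j)\<bar>) * sup_dev r p' p
      + (\<Sum>j\<in>{1..r}. \<bar>partial2 \<phi> (p j, q j)\<bar>) * sup_dev r q' q
      + real r * B * (sup_dev r p' p + sup_dev r q' q)\<^sup>2"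
proof -
  have "\<bar>phi_div r \<phi> p' q' - phi_div r \<phi> p q\<bar> \<le> (\<Sum>j\<in>{1..r}. \<bar>\<phi> (p' j, q' j) - \<phi> (p j, q j)\<bar>)"
    unfolding phi_div_def sum_subtractf[symmetric] by (rule sum_abs)
  also have "\<dots> \<le> (\<Sum>j\<in>{1..r}. \<bar>partial1 \<phi> (p j, q j)\<bar> * \<bar>p' j - p j\<bar>
      + \<bar>partial2 \<phi> (p j, q j)\<bar> * \<bar>q' j - q j\<bar> + B * (\<bar>p' j - p j\<bar> + \<bar>q' j - q j\<bar>)\<^sup>2)"
    using assms by (intro sum_mono B(2)) auto
  also have "\<dots> = (\<Sum>j\<in>{1..r}. \<bar>partial1 \<phi> (p j, q j)\<bar> * \<bar>p' j - p j\<bar>)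
      + (\<Sum>j\<in>{1..r}. \<bar>partial2 \<phi> (p j, q j)\<bar> * \<bar>q' j - q j\<bar>)
      + (\<Sum>j\<in>{1..r}. B * (\<bar>p' j - p j\<bar> + \<bar>q' j - q j\<bar>)\<^sup>2)"
    by (simp add: sum.distrib)
  also have "(\<Sum>j\<in>{1..r}. B * (\<bar>p' j - p j\<bar> + \<bar>q' j - q j\<bar>)\<^sup>2)
      \<le> (\<Sum>j\<in>{1..r}. B * (sup_dev r p' p + sup_dev r q' q)\<^sup>2)"
    using B(1) by (intro sum_mono mult_left_mono power_mono add_mono abs_diff_le_sup_dev) auto
  also have "\<dots> = real r * B * (sup_dev r p' p + sup_dev r q' q)\<^sup>2"
    by simp
  finally show ?thesis
    using sum_weighted_deviation_le[of r "\<lambda>j. \<bar>partial1 \<phi> (p j, q j)\<bar>" p' p]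
      sum_weighted_deviation_le[of r "\<lambda>j. \<bar>partial2 \<phi> (p j, q j)\<bar>" q' q]
    by simp
qed

text \<open>The swapped divergence is expanded at \<open>(q, p)\<close>: there
  \<open>partial1\<close> multiplies the deviation of \<open>q\<close> and yields \<open>A3\<close>,
  while \<open>partial2\<close> multiplies that of \<open>p\<close> and yields \<open>A4\<close>.
  This is why \<open>A1\<close> pairs with \<open>A4\<close> and \<open>A2\<close> with
  \<open>A3\<close>.\<close>

lemma sym_phi_div_expansion:
  assumes \<phi>: "cont_second_partials \<phi>"
    and p: "\<And>j. j \<in> {1..r} \<Longrightarrow> p j \<in> {0..1}" and q: "\<And>j. j \<in> {1..r} \<Longrightarrow> q j \<in> {0..1}"
  obtains C where "C \<ge> 0"
    "\<And>p' q'. \<lbrakk>\<And>j. j \<in> {1..r} \<Longrightarrow> p' j \<in> {0..1}; \<And>j. j \<in> {1..r} \<Longrightarrow> q' j \<in> {0..1}\<rbrakk>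
      \<Longrightarrow> \<bar>sym_phi_div r \<phi> p' q' - sym_phi_div r \<phi> p q\<bar>
        \<le> (1/2) * ((A1 r \<phi> p q + A4 r \<phi> p q) * sup_dev r p' p
                   + (A2 r \<phi> p q + A3 r \<phi> p q) * sup_dev r q' q)
          + C * (sup_dev r p' p + sup_dev r q' q)\<^sup>2"
proof -
  obtain B where B: "B \<ge> 0"
    "\<And>s t s' t'. \<lbrakk>s \<in> {0..1}; t \<in> {0..1}; s' \<in> {0..1}; t' \<in> {0..1}\<rbrakk>
       \<Longrightarrow> \<bar>\<phi> (s', t') - \<phi> (s, t)\<bar> \<le> \<bar>partial1 \<phi> (s, t)\<bar> * \<bar>s' - s\<bar> + \<bar>partial2 \<phi> (s, t)\<bar> * \<bar>t' - t\<bar>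
             + B * (\<bar>s' - s\<bar> + \<bar>t' - t\<bar>)\<^sup>2"
    using cont_second_partials_expansion[OF \<phi>] by blast
  show thesis
  \<comment> \<open>The two divergences have the same remainder, and averaging them leaves it
    unchanged.\<close>
  proof (rule that[of "real r * B"])
    fix p' q' :: "nat \<Rightarrow> real"
    assume p': "\<And>j. j \<in> {1..r} \<Longrightarrow> p' j \<in> {0..1}" and q': "\<And>j. j \<in> {1..r} \<Longrightarrow> q' j \<in> {0..1}"
    show "\<bar>sym_phi_div r \<phi> p' q' - sym_phi_div r \<phi> p q\<bar>
        \<le> (1/2) * ((A1 r \<phi> p q + A4 r \<phi> p q) * sup_dev r p' p
                   + (A2 r \<phi> p q + A3 r \<phi> p q) * sup_dev r q' q)
          + real r * B * (sup_dev r p' p + sup_dev r q' q)\<^sup>2"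
      using phi_div_expansion[where \<phi>=\<phi> and r=r and p=p and q=q and p'=p' and q'=q' and B=B, OF B p q p' q']
        phi_div_expansion[where \<phi>=\<phi> and r=r and p=q and q=p and p'=q' and q'=p' and B=B, OF B q p q' p']
      unfolding sym_phi_div_def A1_def A2_def A3_def A4_def
      by (simp add: algebra_simps add.commute[of "sup_dev r q' q" "sup_dev r p' p"])
  qed (use B in simp)
qed

section \<open>Strong law of large numbers\<close>

text \<open>For fixed \<open>\<epsilon>\<close> the Hoeffding bounds decay geometrically in
  \<open>n\<close>, hence are summable, and Borel-Cantelli leaves only finitely many large
  deviations almost surely.\<close>

lemma (in prob_space) strong_law_bounded:
  fixes X :: "nat \<Rightarrow> 'a \<Rightarrow> real"
  assumes indep: "indep_vars (\<lambda>_. borel) X {1..}"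
    and bnd: "\<And>i. i \<ge> 1 \<Longrightarrow> AE \<omega> in M. X i \<omega> \<in> {a..b}"
    and ab: "a < b"
    and mean: "\<And>i. i \<ge> 1 \<Longrightarrow> expectation (X i) = \<mu>"
  shows "AE \<omega> in M. (\<lambda>n. (\<Sum>i=1..n. X i \<omega>) / real n) \<longlonglongrightarrow> \<mu>"
proof -
  have rv: "X i \<in> borel_measurable M" if "i \<ge> 1" for i
    using indep that by (auto simp: indep_vars_def2)
  have S[measurable]: "(\<lambda>\<omega>. \<Sum>i=1..n. X i \<omega>) \<in> borel_measurable M" for n
    using rv by (intro borel_measurable_sum) auto
  have tail: "AE \<omega> in M. \<forall>\<^sub>F n in sequentially. \<bar>(\<Sum>i=1..n. X i \<omega>) / real n - \<mu>\<bar> < \<epsilon>" if \<epsilon>: "\<epsilon> > 0" for \<epsilon>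
  proof -
    define A where "A n = {\<omega> \<in> space M. \<bar>(\<Sum>i=1..n. X i \<omega>) - real n * \<mu>\<bar> \<ge> real n * \<epsilon>}" for n
    \<comment> \<open>Hoeffding's exponent for a deviation \<open>n * \<epsilon>\<close> of
      \<open>n\<close> terms of width \<open>b - a\<close> is linear in \<open>n\<close>;
      \<open>\<rho>\<close> is the resulting ratio per sample.\<close>
    define \<rho> where "\<rho> = exp (- 2 * \<epsilon>\<^sup>2 / (b - a)\<^sup>2)"
    have meas: "A n \<in> sets M" for n
      unfolding A_def by measurable
    \<comment> \<open>At \<open>n = 0\<close> the sum of squared widths, by which the exponent
      divides, is zero; the comparison of series therefore starts at 1.\<close>
    have bound: "norm (prob (A n)) \<le> 2 * \<rho> ^ n" if n: "n \<ge> 1" for n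
    proof -
      interpret Hoeffding_ineq M "{1..n}" X "\<lambda>_. a" "\<lambda>_. b" "real n * \<mu>"
      proof unfold_locales
        show "indep_vars (\<lambda>_. borel) X {1..n}"
          by (rule indep_vars_subset[OF indep]) auto
        show "AE \<omega> in M. X i \<omega> \<in> {a..b}" if "i \<in> {1..n}" for i
          using bnd that by simp
        show "real n * \<mu> \<equiv> \<Sum>i\<in>{1..n}. expectation (X i)"
          by (rule eq_reflection) (simp add: mean)
      qed simp
      have "prob (A n) \<le> 2 * exp (- 2 * (real n * \<epsilon>)\<^sup>2 / (\<Sum>i\<in>{1..n}. (b - a)\<^sup>2))"
        unfolding A_def using \<epsilon> ab n by (intro Hoeffding_ineq_abs_ge) auto
      also have "- 2 * (real n * \<epsilon>)\<^sup>2 / (\<Sum>i\<in>{1..n}. (b - a)\<^sup>2) = real n * (- 2 * \<epsilon>\<^sup>2 / (b - a)\<^sup>2)"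
        using n ab by (simp add: power2_eq_square)
      also have "exp \<dots> = \<rho> ^ n"
        unfolding \<rho>_def by (rule exp_of_nat_mult)
      finally show ?thesis by simp
    qed
    have "\<rho> < 1"
      using \<epsilon> ab by (simp add: \<rho>_def)
    then have "summable (\<lambda>n. 2 * \<rho> ^ n)"
      by (intro summable_mult summable_geometric) (simp add: \<rho>_def)
    then have "summable (\<lambda>n. prob (A n))"
      by (rule summable_comparison_test'[where N = 1, OF _ bound])
    then have "AE \<omega> in M. \<forall>\<^sub>F n in sequentially. \<omega> \<in> space M - A n"
      using meas by (intro borel_cantelli_AE1) (auto simp: emeasure_eq_measure)
    then show ?thesis
    proof eventually_elim
      case (elim \<omega>)
      from elim eventually_ge_at_top[of 1] show ?case
      proof eventually_elim
        case (elim n)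
        then have "\<bar>(\<Sum>i=1..n. X i \<omega>) - real n * \<mu>\<bar> < real n * \<epsilon>"
          by (simp add: A_def not_le)
        moreover have "(\<Sum>i=1..n. X i \<omega>) - real n * \<mu> = real n * ((\<Sum>i=1..n. X i \<omega>) / real n - \<mu>)"
          using elim by (simp add: field_simps)
        ultimately show ?case
          using elim by (simp add: abs_mult)
      qed
    qed
  qed
  \<comment> \<open>Countably many tolerances suffice for convergence, and the union of their
    exceptional null sets is null.\<close>
  have "AE \<omega> in M. \<forall>k::nat. \<forall>\<^sub>F n in sequentially.
      \<bar>(\<Sum>i=1..n. X i \<omega>) / real n - \<mu>\<bar> < inverse (real (Suc k))"
    unfolding AE_all_countable by (intro allI tail) simp
  then show ?thesis
  proof eventually_elim
    case (elim \<omega>)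
    show ?case
    proof (rule tendstoI)
      fix e :: real assume "e > 0"
      then obtain k where k: "inverse (real (Suc k)) < e"
        using reals_Archimedean by blast
      from elim have "\<forall>\<^sub>F n in sequentially.
          \<bar>(\<Sum>i=1..n. X i \<omega>) / real n - \<mu>\<bar> < inverse (real (Suc k))" by blast
      then show "\<forall>\<^sub>F n in sequentially. dist ((\<Sum>i=1..n. X i \<omega>) / real n) \<mu> < e"
        by eventually_elim (use k in \<open>simp add: dist_real_def\<close>)
    qed
  qed
qed

text \<open>The relative frequency of \<open>c j\<close> is an average of independent indicators
  with values in the unit interval and mean \<open>p\<close>, so the bounded strong law
  applies.\<close>

lemma (in prob_space) empirical_tendsto:
  fixes X :: "nat \<Rightarrow> 'a \<Rightarrow> 'b"
  assumes indep: "indep_vars (\<lambda>_. count_space K) X {1..}"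
    and c: "c j \<in> K"
    and pj: "\<And>i. i \<ge> 1 \<Longrightarrow> prob {\<omega> \<in> space M. X i \<omega> = c j} = p"
  shows "AE \<omega> in M. (\<lambda>n. empirical c X n \<omega> j) \<longlonglongrightarrow> p"
proof -
  let ?Z = "\<lambda>i \<omega>. indicator {c j} (X i \<omega>) :: real"
  have "AE \<omega> in M. (\<lambda>n. (\<Sum>i=1..n. ?Z i \<omega>) / real n) \<longlonglongrightarrow> p"
  proof (rule strong_law_bounded[where a = 0 and b = 1])
    show "indep_vars (\<lambda>_. borel) ?Z {1..}"
      by (rule indep_vars_compose2[OF indep]) auto
    show "expectation (?Z i) = p" if i: "i \<ge> 1" for i
    proof -
      have [measurable]: "X i \<in> measurable M (count_space K)"
        using indep i by (auto simp: indep_vars_def2)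
      \<comment> \<open>As \<open>c j\<close> lies in \<open>K\<close>, its singleton is measurable
        in \<open>count_space K\<close>; measurability of the event identifies its probability with
        the mean of its indicator.\<close>
      have *: "{\<omega> \<in> space M. X i \<omega> = c j} \<in> sets M"
        using measurable_sets[of "X i" M "count_space K" "{c j}"] c
        by (auto simp: vimage_def Int_def conj_commute)
      have "expectation (?Z i) = expectation (indicator {\<omega> \<in> space M. X i \<omega> = c j})"
        by (intro Bochner_Integration.integral_cong) (auto simp: indicator_def)
      also have "\<dots> = p"
        using pj[OF i] * by simp
      finally show ?thesis .
    qed
  qed (auto simp: indicator_def)
  then show ?thesis
    by (simp add: empirical_def)
qed

lemma (in prob_space) sup_dev_empirical_tendsto_0:
  fixes X :: "nat \<Rightarrow> 'a \<Rightarrow> 'b"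
  assumes r: "r \<ge> 1"
    and indep: "indep_vars (\<lambda>_. count_space (c ` {1..r})) X {1..}"
    and p: "\<forall>i\<ge>1. \<forall>j\<in>{1..r}. prob {\<omega> \<in> space M. X i \<omega> = c j} = p j"
  shows "AE \<omega> in M. (\<lambda>n. sup_dev r (empirical c X n \<omega>) p) \<longlonglongrightarrow> 0"
proof -
  \<comment> \<open>Finitely many coordinates share one exceptional null set.\<close>
  have "AE \<omega> in M. \<forall>j\<in>{1..r}. (\<lambda>n. empirical c X n \<omega> j) \<longlonglongrightarrow> p j"
    using p by (intro AE_finite_allI empirical_tendsto[OF indep]) auto
  then show ?thesis
  proof eventually_elim
    case (elim \<omega>)
    have "(\<lambda>n. \<Sum>j\<in>{1..r}. \<bar>empirical c X n \<omega> j - p j\<bar>) \<longlonglongrightarrow> (\<Sum>j\<in>{1..r}. \<bar>p j - p j\<bar>)"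
      using elim by (intro tendsto_intros) auto
    then have lim: "(\<lambda>n. \<Sum>j\<in>{1..r}. \<bar>empirical c X n \<omega> j - p j\<bar>) \<longlonglongrightarrow> 0"
      by simp
    show ?case
      by (rule tendsto_sandwich[OF always_eventually always_eventually tendsto_const lim])
        (use sup_dev_le_sum[OF r] sup_dev_nonneg[OF r] in auto)
  qed
qed

text \<open>This includes \<open>n = 0\<close>, where division by zero makes the value 0; the
  expansion of the divergence is thus available for every sample size.\<close>

lemma empirical_in_unit_interval: "empirical c X n \<omega> j \<in> {0..1}"
proof -
  have "(\<Sum>i=1..n. indicator {c j} (X i \<omega>)) \<le> (\<Sum>i=1..n. 1 :: real)"
    by (intro sum_mono) (auto simp: indicator_def)
  moreover have "0 \<le> (\<Sum>i=1..n. indicator {c j} (X i \<omega>) :: real)"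
    by (intro sum_nonneg) auto
  ultimately show ?thesis
    by (simp add: empirical_def divide_le_eq)
qed

section \<open>Limits superior of the ratios\<close>

text \<open>For \<open>d = 0\<close> the quotient is 0 by the division convention, which matches
  reading 0/0 as 0, and \<open>0 \<le> K\<close> settles that case.\<close>

lemma divide_le_linear:
  fixes x d K C :: real
  assumes "0 \<le> d" "0 \<le> K" "x \<le> K * d + C * d\<^sup>2"
  shows "x / d \<le> K + C * d"
proof (cases "d = 0")
  case False
  with assms have "x \<le> (K + C * d) * d"
    by (simp add: power2_eq_square algebra_simps)
  then show ?thesis
    using False assms by (simp add: divide_le_eq)
qed (use assms in simp)

lemma limsup_ratio_le:
  fixes x d :: "nat \<Rightarrow> real"
  assumes d: "d \<longlonglongrightarrow> 0" "\<And>n. 0 \<le> d n" and K: "0 \<le> K"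
    and x: "\<And>n. x n \<le> K * d n + C * (d n)\<^sup>2"
  shows "limsup (\<lambda>n. ereal (x n / d n)) \<le> ereal K"
proof -
  have "(\<lambda>n. K + C * d n) \<longlonglongrightarrow> K + C * 0"
    by (intro tendsto_intros d)
  then have lim: "(\<lambda>n. ereal (K + C * d n)) \<longlonglongrightarrow> ereal K"
    by simp
  have "limsup (\<lambda>n. ereal (x n / d n)) \<le> limsup (\<lambda>n. ereal (K + C * d n))"
    using d K x by (intro Limsup_mono always_eventually allI) (simp add: divide_le_linear)
  also have "\<dots> = ereal K"
    using lim by (intro lim_imp_Limsup) auto
  finally show ?thesis .
qed

text \<open>It is enough to bound the ratios by \<open>K + e\<close> on a single block
  \<open>{N..} \<times> {N..}\<close> for each \<open>e > 0\<close>.\<close>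

lemma double_limsup_ratio_le:
  fixes x :: "nat \<Rightarrow> nat \<Rightarrow> real" and a b :: "nat \<Rightarrow> real"
  assumes a: "a \<longlonglongrightarrow> 0" "\<And>n. 0 \<le> a n" and b: "b \<longlonglongrightarrow> 0"
    and K: "0 \<le> K" and C: "0 \<le> C"
    and x: "\<And>n m. x n m \<le> K * max (a n) (b m) + C * (max (a n) (b m))\<^sup>2"
  shows "double_limsup (\<lambda>n m. ereal (x n m / max (a n) (b m))) \<le> ereal K"
proof (rule ereal_le_epsilon2)
  fix e :: real assume e: "e > 0"
  \<comment> \<open>Adding 1 keeps the denominator positive when \<open>C = 0\<close> and still
    gives \<open>C * \<delta> \<le> e\<close>.\<close>
  define \<delta> where "\<delta> = e / (C + 1)"
  have \<delta>: "\<delta> > 0" "C * \<delta> \<le> e"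
    using e C by (auto simp: \<delta>_def field_simps)
  \<comment> \<open>Both sequences are made small from the same \<open>N\<close>, because the block
    uses one threshold for both indices.\<close>
  have "\<forall>\<^sub>F n in sequentially. a n < \<delta> \<and> b n < \<delta>"
    using order_tendstoD(2)[OF a(1) \<delta>(1)] order_tendstoD(2)[OF b \<delta>(1)] by (rule eventually_conj)
  then obtain N where N: "\<And>n. n \<ge> N \<Longrightarrow> a n < \<delta> \<and> b n < \<delta>"
    unfolding eventually_sequentially by blast
  have "x n m / max (a n) (b m) \<le> K + e" if "n \<ge> N" "m \<ge> N" for n m
  proof -
    have "x n m / max (a n) (b m) \<le> K + C * max (a n) (b m)"
      using a K x by (intro divide_le_linear) (auto simp: le_max_iff_disj)
    also have "C * max (a n) (b m) \<le> C * \<delta>"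
      using N[OF that(1)] N[OF that(2)] C by (intro mult_left_mono) auto
    finally show ?thesis using \<delta> by simp
  qed
  then have "(SUP (n, m)\<in>{N..} \<times> {N..}. ereal (x n m / max (a n) (b m))) \<le> ereal K + ereal e"
    by (intro SUP_least) auto
  then show "double_limsup (\<lambda>n m. ereal (x n m / max (a n) (b m))) \<le> ereal K + ereal e"
    unfolding double_limsup_eq_INF by (rule INF_lower2[OF UNIV_I])
qed

section \<open>Assembly of the one-sample and two-sample bounds\<close>

lemma prob_vector_in_unit_interval:
  assumes "prob_vector r p" "j \<in> {1..r}"
  shows "p j \<in> {0..1}"
  using assms member_le_sum[of j "{1..r}" p] by (auto simp: prob_vector_def)

theorem theorem3:
  fixes M :: "'a measure"
    and X Y :: "nat \<Rightarrow> 'a \<Rightarrow> 'b"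
    and c :: "nat \<Rightarrow> 'b"
    and r :: nat
    and p q :: "nat \<Rightarrow> real"
    and \<phi> :: "real \<times> real \<Rightarrow> real"
  assumes "prob_space M"
    and "r \<ge> 2"
    and "inj_on c {1..r}"
    and "prob_vector r p"
    and "prob_vector r q"
    and "\<forall>j\<in>{1..r}. p j > 0"
    and "\<forall>j\<in>{1..r}. q j > 0"
    and "\<phi> \<in> borel_measurable (restrict_space borel unit_square)"
    and "cont_second_partials \<phi>"
    and "prob_space.indep_vars M (\<lambda>_. count_space (c ` {1..r})) X {1..}"
    and "prob_space.indep_vars M (\<lambda>_. count_space (c ` {1..r})) Y {1..}"
    and "\<forall>i\<ge>1. \<forall>j\<in>{1..r}. measure M {\<omega> \<in> space M. X i \<omega> = c j} = p j"
    and "\<forall>i\<ge>1. \<forall>j\<in>{1..r}. measure M {\<omega> \<in> space M. Y i \<omega> = c j} = q j"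
    and "prob_space.indep_var M
           (PiM {1..} (\<lambda>_. count_space (c ` {1..r}))) (\<lambda>\<omega>. \<lambda>i\<in>{1..}. X i \<omega>)
           (PiM {1..} (\<lambda>_. count_space (c ` {1..r}))) (\<lambda>\<omega>. \<lambda>i\<in>{1..}. Y i \<omega>)"
  shows "(AE \<omega> in M.
            limsup (\<lambda>n. ereal
              (\<bar>sym_phi_div r \<phi> (empirical c X n \<omega>) q - sym_phi_div r \<phi> p q\<bar>
                / sup_dev r (empirical c X n \<omega>) p))
            \<le> ereal ((1/2) * (A1 r \<phi> p q + A4 r \<phi> p q)))
       \<and> (AE \<omega> in M.
            limsup (\<lambda>m. ereal
              (\<bar>sym_phi_div r \<phi> p (empirical c Y m \<omega>) - sym_phi_div r \<phi> p q\<bar>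
                / sup_dev r (empirical c Y m \<omega>) q))
            \<le> ereal ((1/2) * (A2 r \<phi> p q + A3 r \<phi> p q)))
       \<and> (AE \<omega> in M.
            double_limsup (\<lambda>n m. ereal
              (\<bar>sym_phi_div r \<phi> (empirical c X n \<omega>) (empirical c Y m \<omega>) - sym_phi_div r \<phi> p q\<bar>
                / max (sup_dev r (empirical c X n \<omega>) p) (sup_dev r (empirical c Y m \<omega>) q)))
            \<le> ereal ((1/2) * (A1 r \<phi> p q + A2 r \<phi> p q + A3 r \<phi> p q + A4 r \<phi> p q)))"
proof -
  interpret prob_space M by fact
  have r: "r \<ge> 1" using assms(2) by simp
  have p: "\<And>j. j \<in> {1..r} \<Longrightarrow> p j \<in> {0..1}" and q: "\<And>j. j \<in> {1..r} \<Longrightarrow> q j \<in> {0..1}"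
    using assms(4,5) prob_vector_in_unit_interval by blast+
  \<comment> \<open>\<open>C\<close> is chosen before \<open>p'\<close> and \<open>q'\<close>, so it
    is the same for all sample sizes, all outcomes and all three claims.\<close>
  obtain C where C: "C \<ge> 0"
    and expansion: "\<And>p' q'. \<lbrakk>\<And>j. j \<in> {1..r} \<Longrightarrow> p' j \<in> {0..1}; \<And>j. j \<in> {1..r} \<Longrightarrow> q' j \<in> {0..1}\<rbrakk>
      \<Longrightarrow> \<bar>sym_phi_div r \<phi> p' q' - sym_phi_div r \<phi> p q\<bar>
        \<le> (1/2) * ((A1 r \<phi> p q + A4 r \<phi> p q) * sup_dev r p' p
                   + (A2 r \<phi> p q + A3 r \<phi> p q) * sup_dev r q' q)
          + C * (sup_dev r p' p + sup_dev r q' q)\<^sup>2"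
    using sym_phi_div_expansion[where \<phi>=\<phi> and r=r and p=p and q=q, OF assms(9) p q] by blast
  have A: "0 \<le> A1 r \<phi> p q" "0 \<le> A2 r \<phi> p q" "0 \<le> A3 r \<phi> p q" "0 \<le> A4 r \<phi> p q"
    by (simp_all add: A1_def A2_def A3_def A4_def sum_nonneg)
  have X: "AE \<omega> in M. (\<lambda>n. sup_dev r (empirical c X n \<omega>) p) \<longlonglongrightarrow> 0"
    by (rule sup_dev_empirical_tendsto_0[OF r assms(10,12)])
  have Y: "AE \<omega> in M. (\<lambda>n. sup_dev r (empirical c Y n \<omega>) q) \<longlonglongrightarrow> 0"
    by (rule sup_dev_empirical_tendsto_0[OF r assms(11,13)])
  note self = sup_dev_self[OF r] and nonneg = sup_dev_nonneg[OF r]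
  show ?thesis
  proof (intro conjI)
    show "AE \<omega> in M. limsup (\<lambda>n. ereal
              (\<bar>sym_phi_div r \<phi> (empirical c X n \<omega>) q - sym_phi_div r \<phi> p q\<bar>
                / sup_dev r (empirical c X n \<omega>) p))
            \<le> ereal ((1/2) * (A1 r \<phi> p q + A4 r \<phi> p q))"
      using X
    proof eventually_elim
      case (elim \<omega>)
      show ?case
      proof (rule limsup_ratio_le[OF elim nonneg])
        fix n
        show "\<bar>sym_phi_div r \<phi> (empirical c X n \<omega>) q - sym_phi_div r \<phi> p q\<bar>
            \<le> (1/2) * (A1 r \<phi> p q + A4 r \<phi> p q) * sup_dev r (empirical c X n \<omega>) p
              + C * (sup_dev r (empirical c X n \<omega>) p)\<^sup>2"
          \<comment> \<open>Only the first argument is perturbed: the deviation of \<open>q\<close>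
            from itself is 0, which removes the \<open>A2\<close> and \<open>A3\<close>
            terms.\<close>
          using expansion[of "empirical c X n \<omega>" q, OF empirical_in_unit_interval q]
          by (simp add: self)
      qed (use A in simp)
    qed
    show "AE \<omega> in M. limsup (\<lambda>m. ereal
              (\<bar>sym_phi_div r \<phi> p (empirical c Y m \<omega>) - sym_phi_div r \<phi> p q\<bar>
                / sup_dev r (empirical c Y m \<omega>) q))
            \<le> ereal ((1/2) * (A2 r \<phi> p q + A3 r \<phi> p q))"
      using Y
    proof eventually_elim
      case (elim \<omega>)
      show ?case
      proof (rule limsup_ratio_le[OF elim nonneg])
        fix m
        show "\<bar>sym_phi_div r \<phi> p (empirical c Y m \<omega>) - sym_phi_div r \<phi> p q\<bar>
            \<le> (1/2) * (A2 r \<phi> p q + A3 r \<phi> p q) * sup_dev r (empirical c Y m \<omega>) q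
              + C * (sup_dev r (empirical c Y m \<omega>) q)\<^sup>2"
          \<comment> \<open>Here the deviation of \<open>p\<close> from itself vanishes, and with it
            the \<open>A1\<close> and \<open>A4\<close> terms.\<close>
          using expansion[of p "empirical c Y m \<omega>", OF p empirical_in_unit_interval]
          by (simp add: self)
      qed (use A in simp)
    qed
    show "AE \<omega> in M. double_limsup (\<lambda>n m. ereal
              (\<bar>sym_phi_div r \<phi> (empirical c X n \<omega>) (empirical c Y m \<omega>) - sym_phi_div r \<phi> p q\<bar>
                / max (sup_dev r (empirical c X n \<omega>) p) (sup_dev r (empirical c Y m \<omega>) q)))
            \<le> ereal ((1/2) * (A1 r \<phi> p q + A2 r \<phi> p q + A3 r \<phi> p q + A4 r \<phi> p q))"
      \<comment> \<open>On the intersection of the two almost sure events the rest is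
        deterministic.\<close>
      using X Y
    proof eventually_elim
      case (elim \<omega>)
      show ?case
      proof (rule double_limsup_ratio_le[OF elim(1) nonneg elim(2)])
        fix n m
        define a where "a = sup_dev r (empirical c X n \<omega>) p"
        define b where "b = sup_dev r (empirical c Y m \<omega>) q"
        have ab: "0 \<le> a" "0 \<le> b" by (simp_all add: a_def b_def nonneg)
        have "\<bar>sym_phi_div r \<phi> (empirical c X n \<omega>) (empirical c Y m \<omega>) - sym_phi_div r \<phi> p q\<bar>
            \<le> (1/2) * ((A1 r \<phi> p q + A4 r \<phi> p q) * a + (A2 r \<phi> p q + A3 r \<phi> p q) * b)
              + C * (a + b)\<^sup>2"
          unfolding a_def b_def by (intro expansion empirical_in_unit_interval)
        \<comment> \<open>Both deviations are at most their maximum, so their sum is at most twice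
          it; squaring gives the constant \<open>4 * C\<close>.\<close>
        also have "\<dots> \<le> (1/2) * ((A1 r \<phi> p q + A4 r \<phi> p q) * max a b
              + (A2 r \<phi> p q + A3 r \<phi> p q) * max a b) + C * (2 * max a b)\<^sup>2"
          using A C ab by (intro add_mono mult_left_mono power_mono) auto
        also have "\<dots> = (1/2) * (A1 r \<phi> p q + A2 r \<phi> p q + A3 r \<phi> p q + A4 r \<phi> p q) * max a b
              + (4 * C) * (max a b)\<^sup>2"
          by (simp add: algebra_simps)
        finally show "\<bar>sym_phi_div r \<phi> (empirical c X n \<omega>) (empirical c Y m \<omega>) - sym_phi_div r \<phi> p q\<bar>
            \<le> (1/2) * (A1 r \<phi> p q + A2 r \<phi> p q + A3 r \<phi> p q + A4 r \<phi> p q)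
                * max (sup_dev r (empirical c X n \<omega>) p) (sup_dev r (empirical c Y m \<omega>) q)
              + (4 * C) * (max (sup_dev r (empirical c X n \<omega>) p) (sup_dev r (empirical c Y m \<omega>) q))\<^sup>2"
          unfolding a_def b_def .
      qed (use A C in simp_all)
    qed
  qed
qed

end
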